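(* Let $0\le a\le 1$. The equivalence class of the circular Fréchet–Hoeffding copula upper bound is given by $$M_a(u,v)=\begin{cases}\min(u,v-a) & (u,v)\in[0,1-a]\times[a,1],\\ \min(u+a-1,v) & (u,v)\in[1-a,1]\times[0,a],\\ \max(u+v-1,0) & \text{otherwise.}\end{cases}$$ Here the equivalence class of the circular Fréchet–Hoeffding copula upper bound means the equivalence class $\{C_{\alpha,\beta} : (\alpha,\beta)\in[0,2\pi)^2\}$ of circular copula functions of $H(\theta,\phi)=M(F(\theta),G(\phi))=\min(F(\theta),G(\phi))$, where $F,G$ are circular distribution functions and $M(u,v)=\min(u,v)$ is the Fréchet–Hoeffding upper bound.
   Context: Write $\mathbf I=[0,1]$ and $\mathbf C=[0,2\pi)$. A circular distribution function is a function $F$ with domain $\mathbf C$ such that $F$ is nondecreasing, $F(0)=0$ and $\lim_{\theta\nearrow2\pi}F(\theta)=1$. The quasi-inverse of a circular distribution function $F$ is the function $F^{(-1)}$ with domain $\mathbf I$ given by $F^{(-1)}(u)=\inf\{\theta : F(\theta)\ge u\}$. A circular joint distribution function is a function $H$ with domain $\mathbf C^2$ such that $H(\theta_2,\phi_2)-H(\theta_2,\phi_1)-H(\theta_1,\phi_2)+H(\theta_1,\phi_1)\ge0$ for any rectangle $[\theta_1,\theta_2]\times[\phi_1,\phi_2]$ in $\mathbf C^2$, $H(\theta,0)=H(0,\phi)=0$, and $\lim_{\theta\nearrow2\pi}\lim_{\phi\nearrow2\pi}H(\theta,\phi)=1$. Below, $F$ and $G$ denote the marginal circular distribution functions of $H$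 in $\theta$ and $\phi$ respectively. Extension of $F$ to $[0,4\pi)$: $\tilde F(\theta)=F(\theta)$ for $0\le\theta<2\pi$ and $\tilde F(\theta)=F(\theta-2\pi)+1$ for $2\pi\le\theta<4\pi$; similarly $\tilde G$. Changing the zero direction to $\alpha\in\mathbf C$ gives $F_\alpha(\theta)=\tilde F(\theta+\alpha)-\tilde F(\alpha)$; similarly $G_\beta(\phi)=\tilde G(\phi+\beta)-\tilde G(\beta)$ for $\beta\in\mathbf C$. Extension of $H$ to $[0,4\pi)^2$: $$\tilde H(\theta,\phi)=\begin{cases}H(\theta,\phi) & 0\le\theta<2\pi,\ 0\le\phi<2\pi,\\ F(\theta)+H(\theta,\phi-2\pi) & 0\le\theta<2\pi,\ 2\pi\le\phi<4\pi,\\ G(\phi)+H(\theta-2\pi,\phi) & 2\pi\le\theta<4\pi,\ 0\le\phi<2\pi,\\ 1+F(\theta-2\pi)+G(\phi-2\pi)+H(\theta-2\pi,\phi-2\pi) & 2\pi\le\theta<4\pi,\ 2\pi\le\phi<4\pi.\end{cases}$$ Changing the zero directions to $(\alpha,\beta)\in\mathbf C^2$ gives $$H_{\alpha,\beta}(\theta,\phi)=\tilde H(\theta+\alpha,\phi+\beta)-\tilde H(\alpha,\phi+\beta)-\tilde H(\theta+\alpha,\beta)+\tilde H(\alpha,\beta).$$ The circular copula function with zero directions $(\alpha,\beta)$ is $C_{\alpha,\beta}(u,v)=H_{\alpha,\beta}(F_\alpha^{(-1)}(u),G_\beta^{(-1)}(v))$, where $F_\alpha^{(-1)}$ and $G_\beta^{(-1)}$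 are the quasi-inverses of $F_\alpha$ and $G_\beta$. Since the choice of zero directions is arbitrary, the equivalence class of circular copula functions is defined as $\{C_{\alpha,\beta} : (\alpha,\beta)\in\mathbf C^2\}$.
   Formalization: F and G are assumed continuous on [0,2π); without this the claim fails (F=G=0 on [0,π), 1 on [π,2π) gives C_{0,0}(1/2,1/2)=1, but M_a(1/2,1/2)≤1/2). The infimum of the empty set in the quasi-inverse is taken to be 2π. *)

theory Defs
  imports Complex_Main "HOL-Library.FuncSet"
begin

text \<open>
  Functions on \<open>[0,2\<pi>)\<close> and \<open>[0,2\<pi>)\<^sup>2\<close> are total HOL functions whose values outside the domain are
  never constrained by the definitions of distribution functions and never used by the extensions.
\<close>

definition circular_df :: "(real \<Rightarrow> real) \<Rightarrow> bool" where
  "circular_df F \<longleftrightarrow>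
     mono_on {0..<2*pi} F \<and> F 0 = 0 \<and> (F \<longlongrightarrow> 1) (at_left (2*pi))"

text \<open>
  The infimum is taken in \<open>[0,2\<pi>]\<close>, so the infimum of the empty set is \<open>2\<pi>\<close>. The empty set occurs
  only for \<open>u = 1\<close>, when \<open>F\<close> does not attain the value 1 on \<open>[0,2\<pi>)\<close>.
\<close>

definition quasi_inverse :: "(real \<Rightarrow> real) \<Rightarrow> real \<Rightarrow> real" where
  "quasi_inverse F u =
     (let A = {\<theta> \<in> {0..<2*pi}. F \<theta> \<ge> u} in if A = {} then 2*pi else Inf A)"

definition marginal_fst :: "(real \<Rightarrow> real \<Rightarrow> real) \<Rightarrow> real \<Rightarrow> real" where
  "marginal_fst H \<theta> = Lim (at_left (2*pi)) (\<lambda>\<phi>. H \<theta> \<phi>)"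

definition marginal_snd :: "(real \<Rightarrow> real \<Rightarrow> real) \<Rightarrow> real \<Rightarrow> real" where
  "marginal_snd H \<phi> = Lim (at_left (2*pi)) (\<lambda>\<theta>. H \<theta> \<phi>)"

definition circular_joint_df :: "(real \<Rightarrow> real \<Rightarrow> real) \<Rightarrow> bool" where
  "circular_joint_df H \<longleftrightarrow>
     (\<forall>\<theta>1 \<theta>2 \<phi>1 \<phi>2. 0 \<le> \<theta>1 \<and> \<theta>1 \<le> \<theta>2 \<and> \<theta>2 < 2*pi \<and> 0 \<le> \<phi>1 \<and> \<phi>1 \<le> \<phi>2 \<and> \<phi>2 < 2*pi \<longrightarrow>
        H \<theta>2 \<phi>2 - H \<theta>2 \<phi>1 - H \<theta>1 \<phi>2 + H \<theta>1 \<phi>1 \<ge> 0) \<and>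
     (\<forall>\<theta>\<in>{0..<2*pi}. H \<theta> 0 = 0) \<and> (\<forall>\<phi>\<in>{0..<2*pi}. H 0 \<phi> = 0) \<and>
     (\<forall>\<theta>\<in>{0..<2*pi}. ((\<lambda>\<phi>. H \<theta> \<phi>) \<longlongrightarrow> marginal_fst H \<theta>) (at_left (2*pi))) \<and>
     (marginal_fst H \<longlongrightarrow> 1) (at_left (2*pi))"

definition extend_df :: "(real \<Rightarrow> real) \<Rightarrow> real \<Rightarrow> real" where
  "extend_df F \<theta> = (if \<theta> < 2*pi then F \<theta> else F (\<theta> - 2*pi) + 1)"

definition rotate_df :: "(real \<Rightarrow> real) \<Rightarrow> real \<Rightarrow> real \<Rightarrow> real" where
  "rotate_df F \<alpha> \<theta> = extend_df F (\<theta> + \<alpha>) - extend_df F \<alpha>"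

definition extend_joint_df :: "(real \<Rightarrow> real \<Rightarrow> real) \<Rightarrow> real \<Rightarrow> real \<Rightarrow> real" where
  "extend_joint_df H \<theta> \<phi> =
     (let F = marginal_fst H; G = marginal_snd H in
      if \<theta> < 2*pi \<and> \<phi> < 2*pi then H \<theta> \<phi>
      else if \<theta> < 2*pi then F \<theta> + H \<theta> (\<phi> - 2*pi)
      else if \<phi> < 2*pi then G \<phi> + H (\<theta> - 2*pi) \<phi>
      else 1 + F (\<theta> - 2*pi) + G (\<phi> - 2*pi) + H (\<theta> - 2*pi) (\<phi> - 2*pi))"

definition rotate_joint_df ::
    "(real \<Rightarrow> real \<Rightarrow> real) \<Rightarrow> real \<Rightarrow> real \<Rightarrow> real \<Rightarrow> real \<Rightarrow> real" where
  "rotate_joint_df H \<alpha> \<beta> \<theta> \<phi> =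
     extend_joint_df H (\<theta> + \<alpha>) (\<phi> + \<beta>) - extend_joint_df H \<alpha> (\<phi> + \<beta>)
     - extend_joint_df H (\<theta> + \<alpha>) \<beta> + extend_joint_df H \<alpha> \<beta>"

text \<open>
  Functions on \<open>[0,1]\<^sup>2\<close> are extensional functions on pairs, so that equality of sets of copula
  functions compares them on \<open>[0,1]\<^sup>2\<close> only. A quasi-inverse may take the value \<open>2\<pi>\<close> at 1; the
  formula for \<open>rotate_joint_df\<close> still applies there, since \<open>2\<pi> + \<alpha> < 4\<pi>\<close>.
\<close>

definition circular_copula ::
    "(real \<Rightarrow> real \<Rightarrow> real) \<Rightarrow> real \<Rightarrow> real \<Rightarrow> real \<times> real \<Rightarrow> real" where
  "circular_copula H \<alpha> \<beta> =
     (\<lambda>(u, v)\<in>{0..1} \<times> {0..1}.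
        rotate_joint_df H \<alpha> \<beta>
          (quasi_inverse (rotate_df (marginal_fst H) \<alpha>) u)
          (quasi_inverse (rotate_df (marginal_snd H) \<beta>) v))"

definition circular_copula_class ::
    "(real \<Rightarrow> real \<Rightarrow> real) \<Rightarrow> (real \<times> real \<Rightarrow> real) set" where
  "circular_copula_class H =
     {circular_copula H \<alpha> \<beta> | \<alpha> \<beta>. \<alpha> \<in> {0..<2*pi} \<and> \<beta> \<in> {0..<2*pi}}"

definition FH_upper :: "real \<Rightarrow> real \<Rightarrow> real" where
  "FH_upper u v = min u v"

definition circular_FH_upper :: "real \<Rightarrow> real \<times> real \<Rightarrow> real" where
  "circular_FH_upper a =
     (\<lambda>(u, v)\<in>{0..1} \<times> {0..1}.
        if u \<in> {0..1-a} \<and> v \<in> {a..1} then min u (v - a)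
        else if u \<in> {1-a..1} \<and> v \<in> {0..a} then min (u + a - 1) v
        else max (u + v - 1) 0)"

text \<open>
  The function \<open>\<lambda>\<theta> \<phi>. FH_upper (F \<theta>) (G \<phi>)\<close> is a circular joint distribution function whose
  marginals on \<open>[0,2\<pi>)\<close> are \<open>F\<close> and \<open>G\<close>.
\<close>

lemma circular_df_bounds:
  assumes "circular_df F" "\<theta> \<in> {0..<2*pi}"
  shows "0 \<le> F \<theta>" "F \<theta> \<le> 1"
proof -
  have m: "mono_on {0..<2*pi} F" and z: "F 0 = 0" and l: "(F \<longlongrightarrow> 1) (at_left (2*pi))"
    using assms by (auto simp: circular_df_def)
  have "F 0 \<le> F \<theta>"
    using assms(2) by (intro mono_onD[OF m]) auto
  then show "0 \<le> F \<theta>" using z by simp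
  have "eventually (\<lambda>x. x \<in> {\<theta><..<2*pi}) (at_left (2*pi))"
    using assms(2) by (intro eventually_at_left_real) auto
  then have "eventually (\<lambda>x. F \<theta> \<le> F x) (at_left (2*pi))"
    by eventually_elim (use assms(2) in \<open>auto intro!: mono_onD[OF m]\<close>)
  then show "F \<theta> \<le> 1"
    by (intro tendsto_lowerbound[OF l]) auto
qed

lemma tendsto_FH_upper:
  assumes "circular_df F" "circular_df G"
  shows "\<theta> \<in> {0..<2*pi} \<Longrightarrow> ((\<lambda>\<phi>. FH_upper (F \<theta>) (G \<phi>)) \<longlongrightarrow> F \<theta>) (at_left (2*pi))"
    and "\<phi> \<in> {0..<2*pi} \<Longrightarrow> ((\<lambda>\<theta>. FH_upper (F \<theta>) (G \<phi>)) \<longlongrightarrow> G \<phi>) (at_left (2*pi))"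
proof -
  have F: "(F \<longlongrightarrow> 1) (at_left (2*pi))" and G: "(G \<longlongrightarrow> 1) (at_left (2*pi))"
    using assms by (auto simp: circular_df_def)
  show "((\<lambda>\<phi>. FH_upper (F \<theta>) (G \<phi>)) \<longlongrightarrow> F \<theta>) (at_left (2*pi))" if "\<theta> \<in> {0..<2*pi}"
    using tendsto_min[OF tendsto_const[of "F \<theta>"] G] circular_df_bounds(2)[OF assms(1) that]
    by (simp add: FH_upper_def)
  show "((\<lambda>\<theta>. FH_upper (F \<theta>) (G \<phi>)) \<longlongrightarrow> G \<phi>) (at_left (2*pi))" if "\<phi> \<in> {0..<2*pi}"
    using tendsto_min[OF F tendsto_const[of "G \<phi>"]] circular_df_bounds(2)[OF assms(2) that]
    by (simp add: FH_upper_def)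
qed

lemma marginals_FH_upper:
  assumes "circular_df F" "circular_df G"
  shows "\<theta> \<in> {0..<2*pi} \<Longrightarrow> marginal_fst (\<lambda>\<theta> \<phi>. FH_upper (F \<theta>) (G \<phi>)) \<theta> = F \<theta>"
    and "\<phi> \<in> {0..<2*pi} \<Longrightarrow> marginal_snd (\<lambda>\<theta> \<phi>. FH_upper (F \<theta>) (G \<phi>)) \<phi> = G \<phi>"
  unfolding marginal_fst_def marginal_snd_def
  using tendsto_FH_upper[OF assms] by (auto intro!: tendsto_Lim)

lemma circular_joint_df_FH_upper:
  assumes "circular_df F" "circular_df G"
  shows "circular_joint_df (\<lambda>\<theta> \<phi>. FH_upper (F \<theta>) (G \<phi>))"
  unfolding circular_joint_df_def
proof (intro conjI allI impI ballI)
  have mF: "mono_on {0..<2*pi} F" and mG: "mono_on {0..<2*pi} G"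
    and F0: "F 0 = 0" and G0: "G 0 = 0" and lF: "(F \<longlongrightarrow> 1) (at_left (2*pi))"
    using assms by (auto simp: circular_df_def)
  fix \<theta>1 \<theta>2 \<phi>1 \<phi>2 :: real
  assume r: "0 \<le> \<theta>1 \<and> \<theta>1 \<le> \<theta>2 \<and> \<theta>2 < 2*pi \<and> 0 \<le> \<phi>1 \<and> \<phi>1 \<le> \<phi>2 \<and> \<phi>2 < 2*pi"
  have "F \<theta>1 \<le> F \<theta>2" "G \<phi>1 \<le> G \<phi>2"
    using r by (auto intro!: mono_onD[OF mF] mono_onD[OF mG])
  then show "FH_upper (F \<theta>2) (G \<phi>2) - FH_upper (F \<theta>2) (G \<phi>1)
      - FH_upper (F \<theta>1) (G \<phi>2) + FH_upper (F \<theta>1) (G \<phi>1) \<ge> 0"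
    by (auto simp: FH_upper_def min_def)
next
  fix \<theta> :: real assume "\<theta> \<in> {0..<2*pi}"
  then show "FH_upper (F \<theta>) (G 0) = 0"
    using circular_df_bounds(1)[OF assms(1)] assms(2) by (simp add: FH_upper_def circular_df_def)
next
  fix \<phi> :: real assume "\<phi> \<in> {0..<2*pi}"
  then show "FH_upper (F 0) (G \<phi>) = 0"
    using circular_df_bounds(1)[OF assms(2)] assms(1) by (simp add: FH_upper_def circular_df_def)
next
  fix \<theta> :: real assume "\<theta> \<in> {0..<2*pi}"
  then show "((\<lambda>\<phi>. FH_upper (F \<theta>) (G \<phi>)) \<longlongrightarrow>
      marginal_fst (\<lambda>\<theta> \<phi>. FH_upper (F \<theta>) (G \<phi>)) \<theta>) (at_left (2*pi))"
    using tendsto_FH_upper(1)[OF assms] marginals_FH_upper(1)[OF assms] by simp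
next
  have "eventually (\<lambda>x. x \<in> {0<..<2*pi}) (at_left (2*pi))"
    by (intro eventually_at_left_real) auto
  then have "eventually (\<lambda>x. F x = marginal_fst (\<lambda>\<theta> \<phi>. FH_upper (F \<theta>) (G \<phi>)) x) (at_left (2*pi))"
    by eventually_elim (use marginals_FH_upper(1)[OF assms] in auto)
  moreover have "(F \<longlongrightarrow> 1) (at_left (2*pi))"
    using assms(1) by (simp add: circular_df_def)
  ultimately show "(marginal_fst (\<lambda>\<theta> \<phi>. FH_upper (F \<theta>) (G \<phi>)) \<longlongrightarrow> 1) (at_left (2*pi))"
    by (rule Lim_transform_eventually[rotated])
qed

end

theory Submission
  imports Defs "HOL-Analysis.Elementary_Metric_Spaces"
begin

text \<open>
  Since \<open>F\<close> and \<open>G\<close> are continuous, so are their extensions, and every quasi-inverse is a right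
  inverse. The extension of \<open>min (F \<theta>) (G \<phi>)\<close> is a function of the two extensions alone: it is the
  distribution function of the uniform mass on the diagonal of the unit square, copied
  periodically. Hence \<open>C\<^bsub>\<alpha>,\<beta>\<^esub>\<close> depends only on \<open>s = F \<alpha>\<close> and \<open>t = G \<beta>\<close>. Shifting the origin to
  \<open>(s, t)\<close> moves the diagonal to \<open>v = u + (s - t) mod 1\<close>, which is the support of \<open>M\<^sub>a\<close> with
  \<open>a = (s - t) mod 1\<close>. All \<open>a\<close> occur because \<open>F\<close> takes every value in \<open>[0,1)\<close>, and \<open>M\<^sub>1 = M\<^sub>0\<close>.
\<close>

text \<open>The infimum of a superlevel set of a continuous function again satisfies
  \<open>K \<ge> u\<close>. If the inequality were strict there, the intermediate value theorem
  would give an earlier point of the set.\<close>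

lemma quasi_inverse_right_inverse:
  assumes cont: "continuous_on {0..2*pi} K" and u: "K 0 \<le> u" "u \<le> K (2*pi)"
  shows "quasi_inverse K u \<in> {0..2*pi}" "K (quasi_inverse K u) = u"
proof -
  define A where "A = {\<theta> \<in> {0..<2*pi}. K \<theta> \<ge> u}"
  have q: "quasi_inverse K u = (if A = {} then 2*pi else Inf A)"
    unfolding quasi_inverse_def A_def Let_def by (rule refl)
  have "quasi_inverse K u \<in> {0..2*pi} \<and> K (quasi_inverse K u) = u"
  proof (cases "A = {}")
    case True
    obtain x where x: "0 \<le> x" "x \<le> 2*pi" "K x = u"
      using IVT'[of K 0 u "2*pi"] u cont by auto
    \<comment> \<open>Every point below \<open>2*pi\<close> has \<open>K < u\<close>, so
      \<open>u\<close> is attained exactly at the default value of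
      \<open>quasi_inverse\<close>.\<close>
    with True have "x = 2*pi" unfolding A_def by force
    with x q True show ?thesis by simp
  next
    case False
    \<comment> \<open>\<open>A\<close> omits the endpoint \<open>2*pi\<close> and need not be
      closed; \<open>B\<close> is a closed set containing it, hence also
      \<open>Inf A\<close>.\<close>
    define B where "B = {\<theta> \<in> {0..2*pi}. u \<le> K \<theta>}"
    have "closed B"
      unfolding B_def by (intro continuous_on_closed_Collect_le continuous_on_const cont) auto
    moreover have "A \<subseteq> B" by (auto simp: A_def B_def)
    moreover have bdd: "bdd_below A" by (auto simp: A_def bdd_below_def)
    ultimately have "Inf A \<in> B"
      using closure_contains_Inf[OF False bdd] closure_minimal[of A B] by blast
    then have I: "0 \<le> Inf A" "Inf A \<le> 2*pi" "u \<le> K (Inf A)" by (auto simp: B_def)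
    have "K (Inf A) = u"
    proof (rule ccontr)
      assume ne: "K (Inf A) \<noteq> u"
      obtain x where x: "0 \<le> x" "x \<le> Inf A" "K x = u"
        using IVT'[of K 0 u "Inf A"] u I continuous_on_subset[OF cont, of "{0..Inf A}"] by auto
      have "x < Inf A" using x ne by (cases "x = Inf A") auto
      moreover from this have "x \<in> A" using x I by (simp add: A_def)
      ultimately show False using cInf_lower[OF _ bdd, of x] by simp
    qed
    with I q False show ?thesis by simp
  qed
  then show "quasi_inverse K u \<in> {0..2*pi}" "K (quasi_inverse K u) = u" by auto
qed

lemma quasi_inverse_cong:
  assumes "\<And>\<theta>. \<theta> \<in> {0..<2*pi} \<Longrightarrow> K \<theta> = L \<theta>"
  shows "quasi_inverse K = quasi_inverse L"
proof -
  have "{\<theta> \<in> {0..<2*pi}. K \<theta> \<ge> u} = {\<theta> \<in> {0..<2*pi}. L \<theta> \<ge> u}" for u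
    using assms by auto
  then show ?thesis unfolding quasi_inverse_def by simp
qed

text \<open>The two pieces glue at \<open>2*pi\<close>: the left limit of \<open>F\<close> there is
  1, and the second piece starts at \<open>F 0 + 1 = 1\<close>.\<close>

lemma continuous_on_extend_df:
  assumes F: "circular_df F" and cont: "continuous_on {0..<2*pi} F"
  shows "continuous_on {0..<4*pi} (extend_df F)"
proof -
  have F0: "F 0 = 0" and lF: "(F \<longlongrightarrow> 1) (at_left (2*pi))"
    using F by (auto simp: circular_df_def)
  have at2: "(extend_df F \<longlongrightarrow> extend_df F (2*pi)) (at_left (2*pi))"
    using Lim_transform_eventually[OF lF, of "extend_df F"]
    by (auto simp: eventually_at_filter extend_df_def F0)
  have low: "continuous_on {0..2*pi} (extend_df F)"
    unfolding continuous_on_def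
  proof
    fix x assume x: "x \<in> {0..2*pi}"
    show "(extend_df F \<longlongrightarrow> extend_df F x) (at x within {0..2*pi})"
    proof (cases "x = 2*pi")
      case True
      with at2 show ?thesis
        by (auto simp: at_within_Icc_at_left)
    next
      case False
      with x have x': "x \<in> {0..<2*pi}" by auto
      have "continuous_on {0..<2*pi} (extend_df F)"
        using cont by (simp add: extend_df_def cong: continuous_on_cong_simp)
      then have "(extend_df F \<longlongrightarrow> extend_df F x) (at x within {0..<2*pi})"
        using x' by (auto simp: continuous_on_def)
      moreover have "at x within {0..<2*pi} = at x within {0..2*pi}"
        using x' by (intro at_within_nhd[of _ "{..<2*pi}"]) auto
      ultimately show ?thesis by simp
    qed
  qed
  have "continuous_on {2*pi..<4*pi} (\<lambda>\<theta>. F (\<theta> - 2*pi) + 1)"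
    by (intro continuous_intros continuous_on_compose2[OF cont]) auto
  then have high: "continuous_on {2*pi..<4*pi} (extend_df F)"
    by (simp add: extend_df_def cong: continuous_on_cong_simp)
  have "continuous_on ({0..2*pi} \<union> {2*pi..<4*pi}) (extend_df F)"
    unfolding continuous_on_def
  proof
    fix x assume x: "x \<in> {0..2*pi} \<union> {2*pi..<4*pi}"
    consider "x < 2*pi" | "x = 2*pi" | "x > 2*pi" by linarith
    then show "(extend_df F \<longlongrightarrow> extend_df F x) (at x within {0..2*pi} \<union> {2*pi..<4*pi})"
    proof cases
      case 1
      then have "at x within {0..2*pi} \<union> {2*pi..<4*pi} = at x within {0..2*pi}"
        by (intro at_within_nhd[of _ "{..<2*pi}"]) auto
      with low x 1 show ?thesis by (auto simp: continuous_on_def)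
    next
      case 2
      with low high show ?thesis
        by (auto simp: continuous_on_def at_within_union filterlim_sup)
    next
      case 3
      then have "at x within {0..2*pi} \<union> {2*pi..<4*pi} = at x within {2*pi..<4*pi}"
        by (intro at_within_nhd[of _ "{2*pi<..}"]) auto
      with high x 3 show ?thesis by (auto simp: continuous_on_def)
    qed
  qed
  moreover have "{0..2*pi} \<union> {2*pi..<4*pi} = {0..<4*pi}"
    using pi_gt_zero by (intro ivl_disj_un_two_touch) auto
  ultimately show ?thesis by simp
qed

text \<open>The rotated function rises from 0 to 1 on the closed interval up to \<open>2*pi\<close>,
  because one full turn adds 1 to \<open>extend_df F\<close>. So each \<open>u\<close> lies in its
  range.\<close>

lemma rotate_df_quasi_inverse:
  assumes F: "circular_df F" and cont: "continuous_on {0..<2*pi} F"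
    and \<alpha>: "\<alpha> \<in> {0..<2*pi}" and u: "u \<in> {0..1}"
  defines "q \<equiv> quasi_inverse (rotate_df F \<alpha>) u"
  shows "q \<in> {0..2*pi}" "extend_df F (q + \<alpha>) = F \<alpha> + u"
proof -
  have "continuous_on {0..2*pi} (rotate_df F \<alpha>)"
    unfolding rotate_df_def
    using \<alpha> by (intro continuous_intros continuous_on_compose2[OF continuous_on_extend_df[OF F cont]]) auto
  moreover have "rotate_df F \<alpha> 0 \<le> u" "u \<le> rotate_df F \<alpha> (2*pi)"
    using \<alpha> u by (auto simp: rotate_df_def extend_df_def)
  ultimately have "q \<in> {0..2*pi}" "rotate_df F \<alpha> q = u"
    unfolding q_def by (rule quasi_inverse_right_inverse)+
  then show "q \<in> {0..2*pi}" "extend_df F (q + \<alpha>) = F \<alpha> + u"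
    using \<alpha> by (auto simp: rotate_df_def extend_df_def[of F \<alpha>])
qed

text \<open>For \<open>x\<close> and \<open>y\<close> in [0,2] this is the mass of the rectangle
  [0,x] x [0,y] when each of the four unit cells of [0,2] x [0,2] carries unit mass spread uniformly
  on its own diagonal.\<close>

definition periodic_diagonal_df :: "real \<Rightarrow> real \<Rightarrow> real" where
  "periodic_diagonal_df x y =
     (if x \<le> 1 \<and> y \<le> 1 then min x y
      else if x \<le> 1 then x + min x (y - 1)
      else if y \<le> 1 then y + min (x - 1) y
      else x + y - 1 + min (x - 1) (y - 1))"

lemma extend_df_cong:
  assumes "\<And>\<theta>. \<theta> \<in> {0..<2*pi} \<Longrightarrow> F \<theta> = F' \<theta>" "\<theta> \<in> {0..<4*pi}"
  shows "extend_df F \<theta> = extend_df F' \<theta>"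
  using assms by (auto simp: extend_df_def)

text \<open>
  The case distinctions of the two sides differ where an extension takes the value 1, but the
  formulas agree there.
\<close>

lemma extend_joint_df_FH_upper:
  assumes F: "circular_df F" and G: "circular_df G"
    and \<theta>: "\<theta> \<in> {0..<4*pi}" and \<phi>: "\<phi> \<in> {0..<4*pi}"
  shows "extend_joint_df (\<lambda>\<theta> \<phi>. FH_upper (F \<theta>) (G \<phi>)) \<theta> \<phi> =
           periodic_diagonal_df (extend_df F \<theta>) (extend_df G \<phi>)"
proof -
  note m = marginals_FH_upper[OF F G]
  note b = circular_df_bounds[OF F] circular_df_bounds[OF G]
  consider "\<theta> < 2*pi" "\<phi> < 2*pi" | "\<theta> < 2*pi" "\<phi> \<ge> 2*pi"
    | "\<theta> \<ge> 2*pi" "\<phi> < 2*pi" | "\<theta> \<ge> 2*pi" "\<phi> \<ge> 2*pi" by linarith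
  then show ?thesis
  proof cases
    case 1
    then show ?thesis using \<theta> \<phi> b[of \<theta>] b[of \<phi>]
      by (auto simp: extend_joint_df_def extend_df_def periodic_diagonal_df_def FH_upper_def)
  next
    case 2
    then show ?thesis using \<theta> \<phi> b[of \<theta>] b[of "\<phi> - 2*pi"] m(1)[of \<theta>]
      by (auto simp: extend_joint_df_def extend_df_def periodic_diagonal_df_def FH_upper_def Let_def)
  next
    case 3
    then show ?thesis using \<theta> \<phi> b[of "\<theta> - 2*pi"] b[of \<phi>] m(2)[of \<phi>]
      by (auto simp: extend_joint_df_def extend_df_def periodic_diagonal_df_def FH_upper_def Let_def)
  next
    case 4
    then show ?thesis
      using \<theta> \<phi> b[of "\<theta> - 2*pi"] b[of "\<phi> - 2*pi"] m(1)[of "\<theta> - 2*pi"] m(2)[of "\<phi> - 2*pi"]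
      by (auto simp: extend_joint_df_def extend_df_def periodic_diagonal_df_def FH_upper_def Let_def)
  qed
qed

text \<open>The left side is the mass of [s,s+u] x [t,t+v]. Seen from (s,t), with \<open>a\<close>
  the parameter on the right, the support in the unit square consists of the segments from (0,a) to
  (1-a,1) and from (1-a,0) to (1,a). The two \<open>min\<close> branches each meet one segment; in
  the \<open>max\<close> branch the rectangle meets neither, or both with total mass
  \<open>u + v - 1\<close>.\<close>

lemma periodic_diagonal_df_shift:
  assumes "s \<in> {0..1}" "t \<in> {0..1}" "u \<in> {0..1}" "v \<in> {0..1}"
  shows "periodic_diagonal_df (s + u) (t + v) - periodic_diagonal_df s (t + v)
           - periodic_diagonal_df (s + u) t + periodic_diagonal_df s t =
         circular_FH_upper (if t \<le> s then s - t else s - t + 1) (u, v)"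
proof -
  have M: "circular_FH_upper a (u, v) =
      (if u \<le> 1 - a \<and> a \<le> v then min u (v - a)
       else if 1 - a \<le> u \<and> v \<le> a then min (u + a - 1) v else max (u + v - 1) 0)" for a
    using assms by (auto simp: circular_FH_upper_def)
  show ?thesis
    using assms unfolding M periodic_diagonal_df_def
    \<comment> \<open>Since \<open>s\<close> and \<open>t\<close> are at most 1, these splits settle
      every branch of \<open>periodic_diagonal_df\<close>; what remains is linear
      arithmetic.\<close>
    by (cases "t \<le> s"; cases "s + u \<le> 1"; cases "t + v \<le> 1"; simp; smt (verit))
qed

lemma circular_copula_FH_upper:
  assumes F: "circular_df F" "continuous_on {0..<2*pi} F"
    and G: "circular_df G" "continuous_on {0..<2*pi} G"
    and \<alpha>: "\<alpha> \<in> {0..<2*pi}" and \<beta>: "\<beta> \<in> {0..<2*pi}"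
  shows "circular_copula (\<lambda>\<theta> \<phi>. FH_upper (F \<theta>) (G \<phi>)) \<alpha> \<beta> =
         circular_FH_upper (if G \<beta> \<le> F \<alpha> then F \<alpha> - G \<beta> else F \<alpha> - G \<beta> + 1)"
    (is "circular_copula ?H _ _ = circular_FH_upper ?a")
proof
  fix p :: "real \<times> real"
  obtain u v where p: "p = (u, v)" by (cases p)
  show "circular_copula ?H \<alpha> \<beta> p = circular_FH_upper ?a p"
  proof (cases "u \<in> {0..1} \<and> v \<in> {0..1}")
    case True
    then have u: "u \<in> {0..1}" and v: "v \<in> {0..1}" by auto
    note m = marginals_FH_upper[OF F(1) G(1)]
    define q r where "q = quasi_inverse (rotate_df F \<alpha>) u" and "r = quasi_inverse (rotate_df G \<beta>) v"
    \<comment> \<open>The marginals are known to equal \<open>F\<close> and \<open>G\<close> only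
      below \<open>2*pi\<close>, but the extensions evaluate them only there.\<close>
    have "quasi_inverse (rotate_df (marginal_fst ?H) \<alpha>) = quasi_inverse (rotate_df F \<alpha>)"
      using \<alpha> by (intro quasi_inverse_cong)
        (auto simp: rotate_df_def intro!: arg_cong2[where f = "(-)"] extend_df_cong m)
    moreover have "quasi_inverse (rotate_df (marginal_snd ?H) \<beta>) = quasi_inverse (rotate_df G \<beta>)"
      using \<beta> by (intro quasi_inverse_cong)
        (auto simp: rotate_df_def intro!: arg_cong2[where f = "(-)"] extend_df_cong m)
    ultimately have "circular_copula ?H \<alpha> \<beta> p = rotate_joint_df ?H \<alpha> \<beta> q r"
      using u v by (simp add: circular_copula_def p q_def r_def)
    also have "\<dots> = periodic_diagonal_df (F \<alpha> + u) (G \<beta> + v) - periodic_diagonal_df (F \<alpha>) (G \<beta> + v)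
                   - periodic_diagonal_df (F \<alpha> + u) (G \<beta>) + periodic_diagonal_df (F \<alpha>) (G \<beta>)"
    proof -
      have q: "q \<in> {0..2*pi}" "extend_df F (q + \<alpha>) = F \<alpha> + u"
        unfolding q_def by (rule rotate_df_quasi_inverse[OF F \<alpha> u])+
      have r: "r \<in> {0..2*pi}" "extend_df G (r + \<beta>) = G \<beta> + v"
        unfolding r_def by (rule rotate_df_quasi_inverse[OF G \<beta> v])+
      have "extend_df F \<alpha> = F \<alpha>" "extend_df G \<beta> = G \<beta>"
        using \<alpha> \<beta> by (auto simp: extend_df_def)
      \<comment> \<open>Even if \<open>q\<close> or \<open>r\<close> is \<open>2*pi\<close>, the sum
        stays below \<open>4*pi\<close>, as the zero directions are below
        \<open>2*pi\<close>.\<close>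
      moreover have "q + \<alpha> \<in> {0..<4*pi}" "\<alpha> \<in> {0..<4*pi}" "r + \<beta> \<in> {0..<4*pi}" "\<beta> \<in> {0..<4*pi}"
        using q(1) r(1) \<alpha> \<beta> by auto
      ultimately show ?thesis
        by (simp only: rotate_joint_df_def extend_joint_df_FH_upper[OF F(1) G(1)] q(2) r(2))
    qed
    also have "\<dots> = circular_FH_upper ?a p"
      unfolding p using circular_df_bounds[OF F(1) \<alpha>] circular_df_bounds[OF G(1) \<beta>] u v
      by (intro periodic_diagonal_df_shift) auto
    finally show ?thesis .
  next
    case False
    then show ?thesis by (auto simp: p circular_copula_def circular_FH_upper_def)
  qed
qed

text \<open>Both sides are \<open>min u v\<close> on the unit square. This covers the parameter 1, a
  value that \<open>F\<close> may only approach.\<close>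

lemma circular_FH_upper_1: "circular_FH_upper 1 = circular_FH_upper 0"
  by (auto simp: circular_FH_upper_def fun_eq_iff restrict_def)

text \<open>As \<open>F\<close> tends to 1, it exceeds \<open>a < 1\<close> somewhere before
  \<open>2*pi\<close>; the intermediate value theorem applies up to that point.\<close>

lemma circular_df_surj:
  assumes F: "circular_df F" and cont: "continuous_on {0..<2*pi} F" and a: "0 \<le> a" "a < 1"
  obtains \<alpha> where "\<alpha> \<in> {0..<2*pi}" "F \<alpha> = a"
proof -
  have F0: "F 0 = 0" and lF: "(F \<longlongrightarrow> 1) (at_left (2*pi))"
    using F by (auto simp: circular_df_def)
  have "eventually (\<lambda>x. a < F x \<and> x \<in> {0<..<2*pi}) (at_left (2*pi))"
    using order_tendstoD(1)[OF lF a(2)] by (intro eventually_conj eventually_at_left_real) auto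
  then obtain x where x: "a < F x" "x \<in> {0<..<2*pi}"
    using eventually_happens[of _ "at_left (2*pi)"] by auto
  moreover have "continuous_on {0..x} F"
    using x by (intro continuous_on_subset[OF cont]) auto
  ultimately obtain \<alpha> where "0 \<le> \<alpha>" "\<alpha> \<le> x" "F \<alpha> = a"
    using IVT'[of F 0 a x] a F0 by auto
  with x that[of \<alpha>] show thesis by auto
qed

theorem theorem1:
  fixes F G :: "real \<Rightarrow> real"
  assumes "circular_df F" and "circular_df G"
    and "continuous_on {0..<2*pi} F" and "continuous_on {0..<2*pi} G"
  shows "circular_copula_class (\<lambda>\<theta> \<phi>. FH_upper (F \<theta>) (G \<phi>)) =
         {circular_FH_upper a | a. 0 \<le> a \<and> a \<le> 1}"
proof (intro equalityI subsetI)
  note C = circular_copula_FH_upper[OF assms(1,3,2,4)]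
  fix c assume "c \<in> circular_copula_class (\<lambda>\<theta> \<phi>. FH_upper (F \<theta>) (G \<phi>))"
  then obtain \<alpha> \<beta> where ab: "\<alpha> \<in> {0..<2*pi}" "\<beta> \<in> {0..<2*pi}"
    and "c = circular_copula (\<lambda>\<theta> \<phi>. FH_upper (F \<theta>) (G \<phi>)) \<alpha> \<beta>"
    by (auto simp: circular_copula_class_def)
  then have "c = circular_FH_upper (if G \<beta> \<le> F \<alpha> then F \<alpha> - G \<beta> else F \<alpha> - G \<beta> + 1)"
    using C by simp
  moreover have "0 \<le> F \<alpha>" "F \<alpha> \<le> 1" "0 \<le> G \<beta>" "G \<beta> \<le> 1"
    using ab circular_df_bounds assms by auto
  ultimately show "c \<in> {circular_FH_upper a | a. 0 \<le> a \<and> a \<le> 1}"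
    by (intro CollectI exI[of _ "if G \<beta> \<le> F \<alpha> then F \<alpha> - G \<beta> else F \<alpha> - G \<beta> + 1"]) auto
next
  note C = circular_copula_FH_upper[OF assms(1,3,2,4)]
  fix c assume "c \<in> {circular_FH_upper a | a. 0 \<le> a \<and> a \<le> 1}"
  then obtain b where b: "0 \<le> b" "b \<le> 1" "c = circular_FH_upper b" by blast
  define a where "a = (if b = 1 then 0 else b)"
  have a: "0 \<le> a" "a < 1" "c = circular_FH_upper a"
    using b circular_FH_upper_1 by (auto simp: a_def)
  obtain \<alpha> where \<alpha>: "\<alpha> \<in> {0..<2*pi}" "F \<alpha> = a"
    using circular_df_surj[OF assms(1,3) a(1,2)] .
  \<comment> \<open>With \<open>\<beta> = 0\<close> the parameter of the copula is
    \<open>F \<alpha>\<close> itself, so varying \<open>\<alpha>\<close> alone reaches the whole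
    family.\<close>
  have "G 0 = 0" using assms(2) by (simp add: circular_df_def)
  then have "c = circular_copula (\<lambda>\<theta> \<phi>. FH_upper (F \<theta>) (G \<phi>)) \<alpha> 0"
    using C[OF \<alpha>(1), of 0] \<alpha>(2) a by simp
  moreover have "(0::real) \<in> {0..<2*pi}" by simp
  ultimately show "c \<in> circular_copula_class (\<lambda>\<theta> \<phi>. FH_upper (F \<theta>) (G \<phi>))"
    using \<alpha>(1) unfolding circular_copula_class_def by blast
qed

end
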